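(* For every integer $n\ge 0$, the number of recursively palindromic compositions of $n$ equals the number of partitions of $n$ into parts that are powers of $2$ (binary partitions of $n$).
   Context: A composition of $n$ is a finite sequence $(c_1,\dots,c_m)$ of positive integers with $c_1+\cdots+c_m=n$ (for $n=0$ the only composition is the empty sequence). A sequence $w=(a_1,\dots,a_m)$ has left half $(a_1,\dots,a_k)$ and right half $(a_{m-k+1},\dots,a_m)$ where $k=\lfloor m/2\rfloor$ (for odd $m$ the middle entry belongs to neither half). A sequence is recursively palindromic (RP) if it is empty, or it is a palindrome (equal to its reverse) and both its left half and its right half are recursively palindromic. A composition is RP if its sequence of parts is RP; e.g. $2+1+2+6+2+1+2$ is an RP composition of $16$. A binary partition of $n$ is a multiset of powers of $2$ (i.e. of elements of $\{1,2,4,8,\dots\}$) summing to $n$, with the empty partition counted for $n=0$. *)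

theory Defs
  imports "HOL-Library.Multiset"
begin

definition compositions :: "nat \<Rightarrow> nat list set" where
  "compositions n = {cs. (\<forall>c \<in> set cs. 0 < c) \<and> sum_list cs = n}"

definition left_half :: "'a list \<Rightarrow> 'a list" where
  "left_half xs = take (length xs div 2) xs"

definition right_half :: "'a list \<Rightarrow> 'a list" where
  "right_half xs = drop (length xs - length xs div 2) xs"

function rec_palindromic :: "'a list \<Rightarrow> bool" where
  "rec_palindromic xs \<longleftrightarrow>
     (if xs = [] then True
      else rev xs = xs \<and> rec_palindromic (left_half xs) \<and> rec_palindromic (right_half xs))"
  by pat_completeness auto
termination
proof (relation "measure length")
  fix xs :: "'a list"
  assume "xs \<noteq> []"
  then have "0 < length xs" by simp
  then have "length xs div 2 < length xs" by simp
  then show "(left_half xs, xs) \<in> measure length" "(right_half xs, xs) \<in> measure length"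
    by (simp_all add: left_half_def right_half_def)
qed simp

declare rec_palindromic.simps [simp del]

definition rp_compositions :: "nat \<Rightarrow> nat list set" where
  "rp_compositions n = {cs \<in> compositions n. rec_palindromic cs}"

definition binary_partitions :: "nat \<Rightarrow> nat multiset set" where
  "binary_partitions n = {P. (\<forall>p \<in># P. \<exists>k. p = 2 ^ k) \<and> sum_mset P = n}"

text \<open>Finiteness of both families, so that \<open>card\<close> counts them.\<close>

lemma length_le_sum_list_pos:
  "(\<forall>c \<in> set cs. 0 < c) \<Longrightarrow> length cs \<le> sum_list cs" for cs :: "nat list"
  by (induction cs) auto

lemma finite_compositions: "finite (compositions n)"
proof (rule finite_subset)
  show "compositions n \<subseteq> {cs. set cs \<subseteq> {..n} \<and> length cs \<le> n}"
    using length_le_sum_list_pos member_le_sum_list by (fastforce simp: compositions_def)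
  show "finite {cs. set cs \<subseteq> {..n} \<and> length cs \<le> n}"
    by (rule finite_lists_length_le) simp
qed

lemma finite_rp_compositions: "finite (rp_compositions n)"
  using finite_compositions by (simp add: rp_compositions_def)

lemma finite_binary_partitions: "finite (binary_partitions n)"
proof (rule finite_subset)
  show "binary_partitions n \<subseteq> mset ` compositions n"
  proof
    fix P assume P: "P \<in> binary_partitions n"
    obtain cs where cs: "mset cs = P" using ex_mset by blast
    with P have "cs \<in> compositions n"
      by (fastforce simp: binary_partitions_def compositions_def sum_mset_sum_list)
    with cs show "P \<in> mset ` compositions n" by blast
  qed
  show "finite (mset ` compositions n)" by (simp add: finite_compositions)
qed

lemma "[2, 1, 2, 6, 2, 1, 2] \<in> rp_compositions 16"
  by (simp add: rp_compositions_def compositions_def rec_palindromic.simps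
      left_half_def right_half_def)

end

theory Submission
  imports Defs
begin

text \<open>
  Both counts satisfy \<open>a n = (\<Sum>i \<le> n div 2. a i)\<close>. A recursively palindromic composition of \<open>n\<close>
  has the form \<open>L @ M @ L\<close>, where \<open>L\<close> is an arbitrary recursively palindromic composition of some
  \<open>i \<le> n div 2\<close> and \<open>M\<close> is the part \<open>n - 2 * i\<close>, absent if zero. A binary partition of \<open>n\<close> consists
  of \<open>n - 2 * i\<close> ones and the doubled parts of an arbitrary binary partition of \<open>i\<close>.
\<close>

lemma rec_palindromic_rev: "rec_palindromic xs \<Longrightarrow> rev xs = xs"
  by (cases "xs = []") (simp_all add: rec_palindromic.simps[of xs])

text \<open>Since \<open>M\<close> has at most one entry, half the length, rounded down, is exactly
  \<open>length L\<close>. Both halves are therefore \<open>L\<close>, and \<open>M\<close> is its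
  own reverse.\<close>

lemma rec_palindromic_sandwich:
  assumes "rec_palindromic L" "length M \<le> 1"
  shows "rec_palindromic (L @ M @ L)"
proof -
  have half: "length (L @ M @ L) div 2 = length L"
    using assms(2) by simp
  have "rev M = M"
    using assms(2) by (cases M) auto
  moreover have "left_half (L @ M @ L) = L" "right_half (L @ M @ L) = L"
    unfolding left_half_def right_half_def half by simp_all
  ultimately show ?thesis
    using assms(1) by (simp add: rec_palindromic.simps[of "L @ M @ L"] rec_palindromic_rev)
qed

text \<open>Reversal carries the right half to the left half. The left half is itself a palindrome,
  so the two halves are equal.\<close>

lemma rec_palindromic_sandwichE:
  assumes "rec_palindromic xs"
  obtains L M where "xs = L @ M @ L" "rec_palindromic L" "length M \<le> 1"
proof -
  define k where "k = length xs div 2"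
  define L where "L = left_half xs"
  \<comment> \<open>The length \<open>length xs - 2 * k\<close> is the parity of
    \<open>length xs\<close>, so \<open>M\<close> is the middle entry or empty.\<close>
  define M where "M = take (length xs - 2 * k) (drop k xs)"
  have L: "rec_palindromic L"
    using assms by (cases "xs = []") (auto simp: L_def left_half_def rec_palindromic.simps[of xs])
  have "drop (length xs - k) xs = rev (take k xs)"
    using rec_palindromic_rev[OF assms] by (simp add: rev_take)
  also have "\<dots> = L"
    using rec_palindromic_rev[OF L] by (simp add: L_def left_half_def k_def)
  finally have R: "drop (length xs - k) xs = L" .
  have "drop k xs = M @ drop (length xs - 2 * k) (drop k xs)"
    unfolding M_def by (rule append_take_drop_id[symmetric])
  also have "drop (length xs - 2 * k) (drop k xs) = drop (length xs - k) xs"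
    by (simp add: k_def)
  finally have "xs = L @ M @ L"
    unfolding R by (metis L_def append_take_drop_id k_def left_half_def)
  moreover have "length M \<le> 1"
    by (simp add: M_def k_def)
  ultimately show thesis
    using L that by blast
qed

lemma rp_compositions_eq_image:
  "rp_compositions n =
    (\<lambda>L. L @ (if 2 * sum_list L = n then [] else [n - 2 * sum_list L]) @ L) `
      (\<Union>i\<le>n div 2. rp_compositions i)"
  (is "_ = ?f ` ?U")
proof (intro Set.set_eqI iffI)
  fix xs assume xs: "xs \<in> rp_compositions n"
  then have "rec_palindromic xs"
    by (simp add: rp_compositions_def)
  then obtain L M where LM: "xs = L @ M @ L" "rec_palindromic L" "length M \<le> 1"
    by (rule rec_palindromic_sandwichE)
  \<comment> \<open>Parts are positive, so \<open>M\<close> is empty exactly when the two copies of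
    \<open>L\<close> already sum to \<open>n\<close>.\<close>
  have "L \<in> ?U" "M = (if 2 * sum_list L = n then [] else [n - 2 * sum_list L])"
    using xs LM by (cases M; force simp: rp_compositions_def compositions_def)+
  then show "xs \<in> ?f ` ?U"
    using LM(1) by blast
next
  fix xs assume "xs \<in> ?f ` ?U"
  then obtain L where L: "L \<in> ?U" "xs = ?f L"
    by blast
  then have "rec_palindromic xs" "2 * sum_list L \<le> n" "\<forall>c\<in>set L. 0 < c"
    by (auto simp: rp_compositions_def compositions_def rec_palindromic_sandwich
        simp del: append_Cons append.append_Nil)
  then show "xs \<in> rp_compositions n"
    by (auto simp: rp_compositions_def compositions_def L(2))
qed

text \<open>The length of \<open>L\<close> is half that of the whole list, rounded down, so
  \<open>L\<close> is recovered as a prefix of known length.\<close>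

lemma inj_on_sandwich:
  assumes "\<And>L. L \<in> A \<Longrightarrow> length (M L) \<le> 1"
  shows "inj_on (\<lambda>L. L @ M L @ L) A"
proof (rule inj_onI)
  fix L L' assume *: "L \<in> A" "L' \<in> A" "L @ M L @ L = L' @ M L' @ L'"
  then have "2 * length L + length (M L) = 2 * length L' + length (M L')"
    by (auto dest: arg_cong[of _ _ length])
  with assms[OF *(1)] assms[OF *(2)] have "length L = length L'"
    by presburger
  with *(3) show "L = L'"
    by simp
qed

lemma card_rp_compositions_rec:
  "card (rp_compositions n) = (\<Sum>i\<le>n div 2. card (rp_compositions i))"
proof -
  have "card (rp_compositions n) = card (\<Union>i\<le>n div 2. rp_compositions i)"
    unfolding rp_compositions_eq_image[of n] by (intro card_image inj_on_sandwich) simp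
  also have "\<dots> = (\<Sum>i\<le>n div 2. card (rp_compositions i))"
    \<comment> \<open>The union is disjoint because a composition determines its sum.\<close>
    by (intro card_UN_disjoint ballI impI finite_atMost finite_rp_compositions)
      (auto simp: rp_compositions_def compositions_def)
  finally show ?thesis .
qed

lemma binary_partitions_eq_image:
  "binary_partitions n =
    (\<lambda>Q. replicate_mset (n - 2 * sum_mset Q) 1 + image_mset ((*) 2) Q) `
      (\<Union>i\<le>n div 2. binary_partitions i)"
  (is "_ = ?g ` ?U")
proof (intro Set.set_eqI iffI)
  fix P assume P: "P \<in> binary_partitions n"
  define Q where "Q = image_mset (\<lambda>p. p div 2) (filter_mset (\<lambda>p. p \<noteq> 1) P)"
  \<comment> \<open>The parts other than 1 are even, so the halving in \<open>Q\<close> is exact and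
    yields powers of 2 again.\<close>
  have pow: "\<exists>k. p = 2 * 2 ^ k" if "p \<in># P" "p \<noteq> 1" for p
  proof -
    from P that(1) obtain k where "p = 2 ^ k"
      by (auto simp: binary_partitions_def)
    with that(2) show ?thesis
      by (cases k) auto
  qed
  have "image_mset ((*) 2) Q = image_mset (\<lambda>p. p) (filter_mset (\<lambda>p. p \<noteq> 1) P)"
    unfolding Q_def multiset.map_comp using pow by (intro image_mset_cong) fastforce
  then have PQ: "P = replicate_mset (count P 1) 1 + image_mset ((*) 2) Q"
    using multiset_partition[of P "\<lambda>p. p = 1"] by (simp add: filter_eq_replicate_mset)
  have "sum_mset P = n"
    using P by (simp add: binary_partitions_def)
  then have sum: "n = count P 1 + 2 * sum_mset Q"
    by (subst (asm) PQ) (simp flip: sum_mset_distrib_left)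
  have "\<forall>p\<in>#Q. \<exists>k. p = 2 ^ k"
    using pow by (fastforce simp: Q_def)
  then have "Q \<in> ?U"
    using sum by (auto simp: binary_partitions_def)
  moreover have "P = ?g Q"
    using PQ sum by simp
  ultimately show "P \<in> ?g ` ?U"
    by blast
next
  fix P assume "P \<in> ?g ` ?U"
  then obtain Q where "Q \<in> ?U" and PQ: "P = ?g Q"
    by blast
  then have Q: "2 * sum_mset Q \<le> n" "\<forall>p\<in>#Q. \<exists>k. p = 2 ^ k"
    by (auto simp: binary_partitions_def)
  have "\<exists>k. p = 2 ^ k" if "p \<in># P" for p
  proof (cases "p = 1")
    case True
    then show ?thesis
      by (intro exI[of _ 0]) simp
  next
    case False
    with that PQ obtain q where "q \<in># Q" "p = 2 * q"
      by (auto split: if_splits)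
    with Q(2) show ?thesis
      by (metis power_Suc)
  qed
  moreover have "sum_mset P = n"
    using Q(1) by (simp add: PQ flip: sum_mset_distrib_left)
  ultimately show "P \<in> binary_partitions n"
    by (simp add: binary_partitions_def)
qed

text \<open>Discarding the ones and halving the rest is a left inverse. Doubled parts are even and
  survive the filter, so \<open>m\<close> may be arbitrary.\<close>

lemma inj_on_ones_plus_double:
  "inj_on (\<lambda>Q. replicate_mset (m Q) 1 + image_mset ((*) 2) Q) (A :: nat multiset set)"
proof (rule inj_on_inverseI)
  fix Q :: "nat multiset"
  have "filter_mset (\<lambda>p. p \<noteq> 1) (replicate_mset (m Q) 1 + image_mset ((*) 2) Q)
      = image_mset ((*) 2) Q"
    by (auto simp: filter_mset_image_mset filter_mset_eq_mempty_iff)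
  then show "image_mset (\<lambda>p. p div 2)
      (filter_mset (\<lambda>p. p \<noteq> 1) (replicate_mset (m Q) 1 + image_mset ((*) 2) Q)) = Q"
    by (simp add: multiset.map_comp comp_def)
qed

lemma card_binary_partitions_rec:
  "card (binary_partitions n) = (\<Sum>i\<le>n div 2. card (binary_partitions i))"
proof -
  have "card (binary_partitions n) = card (\<Union>i\<le>n div 2. binary_partitions i)"
    unfolding binary_partitions_eq_image[of n] by (intro card_image inj_on_ones_plus_double)
  also have "\<dots> = (\<Sum>i\<le>n div 2. card (binary_partitions i))"
    by (intro card_UN_disjoint ballI impI finite_atMost finite_binary_partitions)
      (auto simp: binary_partitions_def)
  finally show ?thesis .
qed

theorem theorem2:
  fixes n :: nat
  shows "card (rp_compositions n) = card (binary_partitions n)"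
proof (induction n rule: less_induct)
  case (less n)
  show ?case
  \<comment> \<open>At \<open>n = 0\<close> the recurrence only says that the count equals itself,
    so this case is computed directly. For \<open>n > 0\<close> all indices
    \<open>i \<le> n div 2\<close> lie below \<open>n\<close>.\<close>
  proof (cases "n = 0")
    case True
    have "compositions 0 = {[]}"
      by (auto simp: compositions_def) (metis list.set_intros(1) neq_Nil_conv less_irrefl)
    then have "rp_compositions 0 = {[]}"
      by (auto simp: rp_compositions_def rec_palindromic.simps)
    moreover have "binary_partitions 0 = {{#}}"
      by (auto simp: binary_partitions_def) (metis multiset_nonemptyE power_not_zero zero_neq_numeral)
    ultimately show ?thesis
      using True by simp
  next
    case False
    then show ?thesis
      unfolding card_rp_compositions_rec[of n] card_binary_partitions_rec[of n]
      by (intro sum.cong refl less.IH) auto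
  qed
qed

end
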